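(* Let $G$ be a graph with (exactly) $l$ universal vertices, and let $M(G)$ be the Mycielski graph of $G$. Then $$\mathrm{box}(M(G)) \geq \mathrm{box}(G)+\left\lceil \frac{l}{2}\right\rceil .$$
   Context: All graphs are finite, simple and undirected. A vertex $v$ of $G$ is universal if $v$ is adjacent to all vertices in $V(G)\setminus\{v\}$. $\lceil x\rceil$ denotes the smallest integer at least $x$. Boxicity: a box in Euclidean $k$-space is a Cartesian product $I_1\times\cdots\times I_k$ where each $I_j$ is a closed interval on the real line. The boxicity $\mathrm{box}(G)$ is the minimum nonnegative integer $k$ such that $G$ can be represented as the intersection graph of a family of boxes $(B_v)_{v\in V(G)}$ in Euclidean $k$-space, i.e. for distinct vertices $u,v$, $uv\in E(G)$ if and only if $B_u\cap B_v\neq\emptyset$. The boxicity of a complete graph is defined to be $0$. Mycielski graph: let $V(G)_1,V(G)_2$ be two disjoint copies of $V(G)$, where $v_i\in V(G)_i$ denotes the copy of $v\in V(G)$, and let $z$ be a new vertex. $M(G)$ has vertex set $\{z\}\cup V(G)_1\cup V(G)_2$ (disjoint union) and edge set $E_1\cup E_2\cup E_3$, where $E_1=\{u_1v_1 \mid uv\in E(G)\}$, $E_2=\{u_1v_2,\, v_1u_2 \mid uv\in E(G)\}$, $E_3=\{zu_2\mid u\in V(G)\}$. *)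

theory Defs
  imports Complex_Main "HOL-Library.FuncSet" "Graph_Theory.Pair_Digraph"
begin

text \<open>
  A finite simple undirected graph is a \<open>pair_graph\<close>: a finite vertex set with a symmetric,
  irreflexive set of arcs on it, the edge \<open>uv\<close> being the two arcs \<open>(u, v)\<close> and \<open>(v, u)\<close>.
\<close>

definition universal_vertices :: "'a pair_pre_digraph \<Rightarrow> 'a set" where
  "universal_vertices G = {v \<in> pverts G. \<forall>u \<in> pverts G - {v}. (v, u) \<in> parcs G}"

text \<open>
  Since \<open>k\<close> varies, Euclidean \<open>k\<close>-space is represented by the extensional functions
  \<open>{..<k} \<rightarrow>\<^sub>E UNIV\<close>. Intervals are nonempty and bounded. For \<open>k = 0\<close> the space is
  a single point, which is also the only box.
\<close>

definition is_box :: "nat \<Rightarrow> (nat \<Rightarrow> real) set \<Rightarrow> bool" where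
  "is_box k B \<longleftrightarrow> (\<exists>a b. (\<forall>j<k. a j \<le> b j) \<and> B = (\<Pi>\<^sub>E j\<in>{..<k}. {a j..b j}))"

definition box_representation ::
    "nat \<Rightarrow> 'a pair_pre_digraph \<Rightarrow> ('a \<Rightarrow> (nat \<Rightarrow> real) set) \<Rightarrow> bool" where
  "box_representation k G B \<longleftrightarrow>
     (\<forall>v \<in> pverts G. is_box k (B v)) \<and>
     (\<forall>u \<in> pverts G. \<forall>v \<in> pverts G. u \<noteq> v \<longrightarrow> ((u, v) \<in> parcs G \<longleftrightarrow> B u \<inter> B v \<noteq> {}))"

text \<open>
  The convention that complete graphs have boxicity 0 is the case \<open>k = 0\<close>
  (lemma \<open>boxicity_eq_0_iff\<close>); the minimum is attained for every finite simple graph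
  (lemma \<open>boxicity_attained\<close>).
\<close>

definition boxicity :: "'a pair_pre_digraph \<Rightarrow> nat" where
  "boxicity G = (LEAST k. \<exists>B. box_representation k G B)"

text \<open>\<open>Copy1 v\<close>, \<open>Copy2 v\<close> and \<open>Apex\<close> are the vertices $v_1$, $v_2$ and $z$.\<close>

datatype 'a mycielski_vertex = Apex | Copy1 'a | Copy2 'a

definition mycielski :: "'a pair_pre_digraph \<Rightarrow> 'a mycielski_vertex pair_pre_digraph" where
  "mycielski G = \<lparr>
     pverts = {Apex} \<union> Copy1 ` pverts G \<union> Copy2 ` pverts G,
     parcs = {(Copy1 u, Copy1 v) | u v. (u, v) \<in> parcs G}
           \<union> {(Copy1 u, Copy2 v) | u v. (u, v) \<in> parcs G}
           \<union> {(Copy2 u, Copy1 v) | u v. (u, v) \<in> parcs G}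
           \<union> {(Apex, Copy2 u) | u. u \<in> pverts G}
           \<union> {(Copy2 u, Apex) | u. u \<in> pverts G} \<rparr>"

lemma pair_graph_mycielski:
  assumes "pair_graph G"
  shows "pair_graph (mycielski G)"
proof -
  interpret pair_graph G by fact
  have fin: "finite (pverts (mycielski G))"
    by (simp add: mycielski_def)
  have sub: "parcs (mycielski G) \<subseteq> pverts (mycielski G) \<times> pverts (mycielski G)"
    using wellformed' by (auto simp: mycielski_def)
  have sym: "(v, u) \<in> parcs G" if "(u, v) \<in> parcs G" for u v
    using that pair_sym_arcs by (auto simp: symmetric_def sym_def)
  show ?thesis
  proof unfold_locales
    show "finite (parcs (mycielski G))"
      using fin sub by (meson finite_SigmaI finite_subset)
    show "symmetric (with_proj (mycielski G))"
      unfolding symmetric_def by (intro symI) (auto simp: mycielski_def intro: sym)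
    show "fst e \<noteq> snd e" if "e \<in> parcs (mycielski G)" for e
      using that pair_no_loops by (auto simp: mycielski_def)
  qed (use fin sub in auto)
qed

text \<open>
  One dimension per vertex: in dimension \<open>w\<close>, the vertex \<open>w\<close> gets $[0,0]$, its neighbours
  get $[0,1]$ and all other vertices get $[1,1]$.
\<close>

lemma box_representation_exists:
  assumes "pair_graph G"
  shows "\<exists>k B. box_representation k G B"
proof -
  interpret pair_graph G by fact
  have sym: "(v, u) \<in> parcs G" if "(u, v) \<in> parcs G" for u v
    using that pair_sym_arcs by (auto simp: symmetric_def sym_def)
  define n where "n = card (pverts G)"
  obtain w where w: "bij_betw w {..<n} (pverts G)"
    using ex_bij_betw_nat_finite[OF pair_finite_verts]
    unfolding n_def lessThan_atLeast0 by blast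
  define a :: "_ \<Rightarrow> nat \<Rightarrow> real"
    where "a v j = (if v = w j \<or> (w j, v) \<in> parcs G then 0 else 1)" for v j
  define b :: "_ \<Rightarrow> nat \<Rightarrow> real" where "b v j = (if v = w j then 0 else 1)" for v j
  define B where "B v = (\<Pi>\<^sub>E j\<in>{..<n}. {a v j..b v j})" for v
  have ab: "a v j \<le> b v j" for v j
    by (simp add: a_def b_def)
  have box: "is_box n (B v)" for v
    unfolding is_box_def B_def using ab by blast
  have "(u, v) \<in> parcs G \<longleftrightarrow> B u \<inter> B v \<noteq> {}"
    if uv: "u \<in> pverts G" "v \<in> pverts G" "u \<noteq> v" for u v
  proof
    assume e: "(u, v) \<in> parcs G"
    let ?x = "\<lambda>j\<in>{..<n}. if w j = u \<or> w j = v then 0 else 1 :: real"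
    have "(if w j = u \<or> w j = v then 0 else 1) \<in> {a u j..b u j} \<inter> {a v j..b v j}" for j
      using e sym[OF e] uv(3) unfolding a_def b_def by (cases "w j = u"; cases "w j = v") simp_all
    then have "?x \<in> B u" "?x \<in> B v"
      unfolding B_def by (intro restrict_PiE_iff[THEN iffD2] ballI; blast)+
    then show "B u \<inter> B v \<noteq> {}" by blast
  next
    assume "B u \<inter> B v \<noteq> {}"
    then obtain x where x: "x \<in> B u" "x \<in> B v" by blast
    obtain i where i: "i < n" "w i = u"
      using w uv(1) unfolding bij_betw_def by (metis imageE lessThan_iff)
    have "x i \<in> {a u i..b u i}" "x i \<in> {a v i..b v i}"
      using x i(1) by (auto simp: B_def PiE_def Pi_def)
    then show "(u, v) \<in> parcs G"
      using i uv(3) by (auto simp: a_def b_def split: if_splits)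
  qed
  with box show ?thesis unfolding box_representation_def by blast
qed

lemma boxicity_attained:
  assumes "pair_graph G"
  shows "\<exists>B. box_representation (boxicity G) G B"
  unfolding boxicity_def by (rule LeastI_ex) (rule box_representation_exists[OF assms])

lemma boxicity_le: "box_representation k G B \<Longrightarrow> boxicity G \<le> k"
  unfolding boxicity_def by (rule Least_le) blast

lemma boxicity_eq_0_iff:
  assumes "pair_graph G"
  shows "boxicity G = 0 \<longleftrightarrow>
    (\<forall>u \<in> pverts G. \<forall>v \<in> pverts G. u \<noteq> v \<longrightarrow> (u, v) \<in> parcs G)"
proof
  assume "boxicity G = 0"
  then obtain B where B: "box_representation 0 G B"
    using boxicity_attained[OF assms] by auto
  then have "B v = {\<lambda>_. undefined}" if "v \<in> pverts G" for v
    using that by (auto simp: box_representation_def is_box_def)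
  with B show "\<forall>u \<in> pverts G. \<forall>v \<in> pverts G. u \<noteq> v \<longrightarrow> (u, v) \<in> parcs G"
    by (auto simp: box_representation_def)
next
  assume "\<forall>u \<in> pverts G. \<forall>v \<in> pverts G. u \<noteq> v \<longrightarrow> (u, v) \<in> parcs G"
  then have "box_representation 0 G (\<lambda>_. {\<lambda>_. undefined})"
    by (auto simp: box_representation_def is_box_def)
  then show "boxicity G = 0" using boxicity_le by fastforce
qed

end

theory Submission
  imports Defs
begin

text \<open>
  A box representation gives each vertex one interval per dimension, and two vertices are adjacent
  iff their intervals meet in every dimension. Take such a representation of the Mycielski graph.
  For a universal vertex \<open>w\<close> the copies \<open>Copy1 w\<close> and \<open>Copy2 w\<close> are not adjacent, so
  some dimension separates them. Two facts about such a dimension prove the theorem.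

  The dimension is useless for \<open>G\<close>: every vertex \<open>v \<noteq> w\<close> of \<open>G\<close> is adjacent to \<open>w\<close>, so
  \<open>Copy1 v\<close> meets both of these disjoint intervals and hence contains the gap between them
  (\<open>interval_gap\<close>). The intervals of all these first copies thus share the gap, and no
  non-edge of \<open>G\<close>, which avoids \<open>w\<close>, is separated there. Since the first copies induce \<open>G\<close>, the
  dimensions that separate no such pair already represent \<open>G\<close>.

  The dimension serves at most two universal vertices: at most one whose first copy lies to the
  left of its second copy, and at most one for which it lies to the right
  (\<open>crossing_intervals\<close>). With \<open>l\<close> universal vertices at least \<open>\<lceil>l / 2\<rceil>\<close> dimensions
  are therefore lost to \<open>G\<close>.
\<close>

text \<open>
  The end points of the boxes, dimension by dimension. The dimensions form an arbitrary set, so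
  that dimensions can be discarded without renumbering the others.
\<close>

definition interval_representation ::
    "'d set \<Rightarrow> 'a pair_pre_digraph \<Rightarrow> ('a \<Rightarrow> 'd \<Rightarrow> real) \<Rightarrow> ('a \<Rightarrow> 'd \<Rightarrow> real) \<Rightarrow> bool" where
  "interval_representation D G lo hi \<longleftrightarrow>
     (\<forall>v \<in> pverts G. \<forall>j \<in> D. lo v j \<le> hi v j) \<and>
     (\<forall>u \<in> pverts G. \<forall>v \<in> pverts G. u \<noteq> v \<longrightarrow>
        ((u, v) \<in> parcs G \<longleftrightarrow> (\<forall>j \<in> D. lo u j \<le> hi v j \<and> lo v j \<le> hi u j)))"

lemma boxes_meet_iff:
  fixes a b c d :: "'d \<Rightarrow> real"
  assumes "\<forall>j \<in> D. a j \<le> b j" "\<forall>j \<in> D. c j \<le> d j"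
  shows "(\<Pi>\<^sub>E j\<in>D. {a j..b j}) \<inter> (\<Pi>\<^sub>E j\<in>D. {c j..d j}) \<noteq> {} \<longleftrightarrow>
    (\<forall>j \<in> D. a j \<le> d j \<and> c j \<le> b j)"
proof -
  have "(\<Pi>\<^sub>E j\<in>D. {a j..b j}) \<inter> (\<Pi>\<^sub>E j\<in>D. {c j..d j}) \<noteq> {} \<longleftrightarrow>
      (\<forall>j \<in> D. {a j..b j} \<inter> {c j..d j} \<noteq> {})"
    by (simp add: PiE_Int PiE_eq_empty_iff)
  also have "\<dots> \<longleftrightarrow> (\<forall>j \<in> D. a j \<le> d j \<and> c j \<le> b j)"
    using assms by (intro ball_cong) auto
  finally show ?thesis .
qed

lemma box_representation_imp_interval_representation:
  assumes "box_representation k G B"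
  obtains lo hi where "interval_representation {..<k} G lo hi"
proof -
  have "\<forall>v \<in> pverts G. \<exists>a b. (\<forall>j<k. a j \<le> b j) \<and> B v = (\<Pi>\<^sub>E j\<in>{..<k}. {a j..b j})"
    using assms by (simp add: box_representation_def is_box_def)
  then obtain lo hi where bounds:
    "\<forall>v \<in> pverts G. (\<forall>j<k. lo v j \<le> hi v j) \<and> B v = (\<Pi>\<^sub>E j\<in>{..<k}. {lo v j..hi v j})"
    by metis
  have "(u, v) \<in> parcs G \<longleftrightarrow> (\<forall>j \<in> {..<k}. lo u j \<le> hi v j \<and> lo v j \<le> hi u j)"
    if "u \<in> pverts G" "v \<in> pverts G" "u \<noteq> v" for u v
  proof -
    have "(u, v) \<in> parcs G \<longleftrightarrow> B u \<inter> B v \<noteq> {}"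
      using assms that by (simp add: box_representation_def)
    then show ?thesis
      using bounds that boxes_meet_iff[of "{..<k}" "lo u" "hi u" "lo v" "hi v"] by simp
  qed
  with bounds have "interval_representation {..<k} G lo hi"
    by (simp add: interval_representation_def)
  then show thesis by (rule that)
qed

lemma boxicity_le_card:
  assumes rep: "interval_representation D G lo hi" and "finite D"
  shows "boxicity G \<le> card D"
proof -
  obtain e where e: "bij_betw e {..<card D} D"
    using ex_bij_betw_nat_finite[OF \<open>finite D\<close>] unfolding lessThan_atLeast0 by blast
  then have "D = e ` {..<card D}" by (simp add: bij_betw_def)
  then have all_D: "(\<forall>j \<in> D. P j) \<longleftrightarrow> (\<forall>i \<in> {..<card D}. P (e i))" for P
    by (metis ball_simps(9))
  let ?B = "\<lambda>v. \<Pi>\<^sub>E i\<in>{..<card D}. {lo v (e i)..hi v (e i)}"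
  have ordered: "\<forall>i \<in> {..<card D}. lo v (e i) \<le> hi v (e i)" if "v \<in> pverts G" for v
    using rep that by (simp add: interval_representation_def all_D)
  have "is_box (card D) (?B v)" if "v \<in> pverts G" for v
    unfolding is_box_def using ordered[OF that]
    by (intro exI[of _ "\<lambda>i. lo v (e i)"] exI[of _ "\<lambda>i. hi v (e i)"]) simp
  moreover have "(u, v) \<in> parcs G \<longleftrightarrow> ?B u \<inter> ?B v \<noteq> {}"
    if "u \<in> pverts G" "v \<in> pverts G" "u \<noteq> v" for u v
    using rep that boxes_meet_iff[OF ordered ordered, of u v]
    by (simp add: interval_representation_def all_D)
  ultimately have "box_representation (card D) G ?B"
    by (simp add: box_representation_def)
  then show ?thesis by (rule boxicity_le)
qed

text \<open>
  Since \<open>{a..b}\<close> and \<open>{c..d}\<close> each meet both of the disjoint intervals \<open>{p..q}\<close> and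
  \<open>{r..s}\<close>, both contain the gap between them, on whichever side of \<open>{p..q}\<close> the
  interval \<open>{r..s}\<close> lies.
\<close>

lemma interval_gap:
  fixes a b c d p q r s :: real
  assumes "q < r \<or> s < p"
    and "a \<le> q" "p \<le> b" "a \<le> s" "r \<le> b"
    and "c \<le> q" "p \<le> d" "c \<le> s" "r \<le> d"
  shows "a \<le> d"
  using assms by linarith

text \<open>
  The reason why two universal vertices cannot have their copies separated in the same dimension
  and in the same order: each vertex's first copy meets the other's second copy, so with \<open>b\<close>,
  \<open>b'\<close> the right ends of the left copies and \<open>c\<close>, \<open>c'\<close> the left ends of the right ones, the
  inequalities form the cycle \<open>b < c \<le> b' < c' \<le> b\<close>.
\<close>

lemma crossing_intervals:
  fixes b c b' c' :: real
  assumes "b < c" "b' < c'" "c' \<le> b" "c \<le> b'"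
  shows False
  using assms by linarith

theorem theorem3p4:
  fixes G :: "'a pair_pre_digraph" and l :: nat
  assumes "pair_graph G"
    and "card (universal_vertices G) = l"
  shows "boxicity (mycielski G) \<ge> boxicity G + nat \<lceil>real l / 2\<rceil>"
proof -
  interpret pair_graph G by fact
  let ?U = "universal_vertices G"
  define k where "k = boxicity (mycielski G)"
  obtain B where "box_representation k (mycielski G) B"
    using boxicity_attained[OF pair_graph_mycielski[OF assms(1)]] unfolding k_def by blast
  then obtain lo hi where rep: "interval_representation {..<k} (mycielski G) lo hi"
    by (rule box_representation_imp_interval_representation)

  have verts: "Copy1 v \<in> pverts (mycielski G)" "Copy2 v \<in> pverts (mycielski G)"
    if "v \<in> pverts G" for v
    using that by (simp_all add: mycielski_def)
  have ordered: "lo (Copy1 v) j \<le> hi (Copy1 v) j"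
    if "v \<in> pverts G" "j < k" for v j
    using rep verts that by (simp_all add: interval_representation_def)
  have arc11: "(u, v) \<in> parcs G \<longleftrightarrow>
      (\<forall>j \<in> {..<k}. lo (Copy1 u) j \<le> hi (Copy1 v) j \<and> lo (Copy1 v) j \<le> hi (Copy1 u) j)"
    if "u \<in> pverts G" "v \<in> pverts G" "u \<noteq> v" for u v
  proof -
    have "(Copy1 u, Copy1 v) \<in> parcs (mycielski G) \<longleftrightarrow> (u, v) \<in> parcs G"
      by (auto simp: mycielski_def)
    then show ?thesis
      using rep verts that by (simp add: interval_representation_def)
  qed
  have arc12: "(u, v) \<in> parcs G \<longleftrightarrow>
      (\<forall>j \<in> {..<k}. lo (Copy1 u) j \<le> hi (Copy2 v) j \<and> lo (Copy2 v) j \<le> hi (Copy1 u) j)"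
    if "u \<in> pverts G" "v \<in> pverts G" for u v
  proof -
    have "(Copy1 u, Copy2 v) \<in> parcs (mycielski G) \<longleftrightarrow> (u, v) \<in> parcs G"
      by (auto simp: mycielski_def)
    then show ?thesis
      using rep verts that by (simp add: interval_representation_def)
  qed
  have univ: "w \<in> pverts G" "\<And>v. v \<in> pverts G \<Longrightarrow> v \<noteq> w \<Longrightarrow> (w, v) \<in> parcs G \<and> (v, w) \<in> parcs G"
    if "w \<in> ?U" for w
    using that pair_sym_arcs
    by (auto simp: universal_vertices_def symmetric_def sym_def)

  \<comment> \<open>\<open>J\<close> collects the dimensions that are lost to \<open>G\<close>.\<close>
  define sep where "sep w j \<longleftrightarrow> hi (Copy1 w) j < lo (Copy2 w) j \<or> hi (Copy2 w) j < lo (Copy1 w) j"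
    for w j
  define J where "J = {j. j < k \<and> (\<exists>w \<in> ?U. sep w j)}"
  have J: "J \<subseteq> {..<k}" by (auto simp: J_def)
  then have "finite J" by (rule finite_subset) simp

  have "interval_representation ({..<k} - J) G (\<lambda>v. lo (Copy1 v)) (\<lambda>v. hi (Copy1 v))"
  proof -
    have "lo (Copy1 u) j \<le> hi (Copy1 v) j"
      if uv: "u \<in> pverts G" "v \<in> pverts G" "u \<noteq> v" "(u, v) \<notin> parcs G" and "j \<in> J" for u v j
    proof -
      obtain w where w: "w \<in> ?U" "sep w j" and "j < k"
        using \<open>j \<in> J\<close> by (auto simp: J_def)
      \<comment> \<open>A non-edge cannot contain a universal vertex, so \<open>w\<close> is adjacent to both its ends.\<close>
      have "u \<noteq> w" "v \<noteq> w"
        using uv univ(2)[OF w(1), of u] univ(2)[OF w(1), of v] by auto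
      then have meet: "(u, w) \<in> parcs G" "(v, w) \<in> parcs G"
        using uv univ(2)[OF w(1)] by blast+
      have "w \<in> pverts G" by (rule univ(1)[OF w(1)])
      have meet1: "lo (Copy1 u) j \<le> hi (Copy1 w) j" "lo (Copy1 w) j \<le> hi (Copy1 u) j"
          "lo (Copy1 v) j \<le> hi (Copy1 w) j" "lo (Copy1 w) j \<le> hi (Copy1 v) j"
        using arc11[of u w] arc11[of v w] uv meet \<open>w \<in> pverts G\<close> \<open>u \<noteq> w\<close> \<open>v \<noteq> w\<close> \<open>j < k\<close> by simp_all
      have meet2: "lo (Copy1 u) j \<le> hi (Copy2 w) j" "lo (Copy2 w) j \<le> hi (Copy1 u) j"
          "lo (Copy1 v) j \<le> hi (Copy2 w) j" "lo (Copy2 w) j \<le> hi (Copy1 v) j"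
        using arc12[of u w] arc12[of v w] uv meet \<open>w \<in> pverts G\<close> \<open>j < k\<close> by simp_all
      show ?thesis
        by (rule interval_gap[OF w(2)[unfolded sep_def]
              meet1(1,2) meet2(1,2) meet1(3,4) meet2(3,4)])
    qed
    moreover have "(v, u) \<notin> parcs G" if "(u, v) \<notin> parcs G" for u v
      using that pair_sym_arcs by (auto simp: symmetric_def sym_def)
    ultimately have "(u, v) \<in> parcs G \<longleftrightarrow>
        (\<forall>j \<in> {..<k} - J. lo (Copy1 u) j \<le> hi (Copy1 v) j \<and> lo (Copy1 v) j \<le> hi (Copy1 u) j)"
      if "u \<in> pverts G" "v \<in> pverts G" "u \<noteq> v" for u v
      using arc11[OF that] that by (metis Diff_iff)
    then show ?thesis
      using ordered by (simp add: interval_representation_def)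
  qed
  then have "boxicity G \<le> card ({..<k} - J)"
    by (rule boxicity_le_card) simp
  also have "\<dots> = k - card J"
    using J by (simp add: card_Diff_subset finite_subset)
  finally have box_G: "boxicity G \<le> k - card J" .

  have "l \<le> 2 * card J"
  proof -
    have "\<exists>j. j < k \<and> sep w j" if "w \<in> ?U" for w
      using arc12[of w w] univ(1)[OF that] pair_no_loops by (force simp: sep_def not_le)
    then obtain dim where dim: "\<And>w. w \<in> ?U \<Longrightarrow> dim w < k \<and> sep w (dim w)"
      by metis
    \<comment> \<open>A dimension has two slots, one for each order of the two copies; no slot is taken
      twice.\<close>
    define left where "left w \<longleftrightarrow> hi (Copy1 w) (dim w) < lo (Copy2 w) (dim w)" for w
    have "inj_on (\<lambda>w. (dim w, left w)) ?U"
    proof (rule inj_onI, rule ccontr)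
      fix u v
      assume uv: "u \<in> ?U" "v \<in> ?U" "(dim u, left u) = (dim v, left v)" "u \<noteq> v"
      define j where "j = dim u"
      have j: "dim u = j" "dim v = j" "left u = left v" "j < k"
        using uv dim[of u] by (simp_all add: j_def)
      have arcs: "(u, v) \<in> parcs G" "(v, u) \<in> parcs G"
        using univ[OF uv(1)] univ(1)[OF uv(2)] uv(4) by blast+
      have meet: "lo (Copy1 u) j \<le> hi (Copy2 v) j" "lo (Copy2 v) j \<le> hi (Copy1 u) j"
          "lo (Copy1 v) j \<le> hi (Copy2 u) j" "lo (Copy2 u) j \<le> hi (Copy1 v) j"
        using arc12[of u v] arc12[of v u] univ(1)[OF uv(1)] univ(1)[OF uv(2)] arcs j(4) by simp_all
      show False
      proof (cases "left u")
        case True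
        then have "hi (Copy1 u) j < lo (Copy2 u) j" "hi (Copy1 v) j < lo (Copy2 v) j"
          using j by (simp_all add: left_def)
        then show False
          using meet(2,4) by (rule crossing_intervals)
      next
        case False
        then have "hi (Copy2 u) j < lo (Copy1 u) j" "hi (Copy2 v) j < lo (Copy1 v) j"
          using j dim[OF uv(1)] dim[OF uv(2)] by (auto simp: left_def sep_def)
        then show False
          using meet(3,1) by (rule crossing_intervals)
      qed
    qed
    moreover have "(\<lambda>w. (dim w, left w)) ` ?U \<subseteq> J \<times> UNIV"
      using dim by (auto simp: J_def)
    ultimately have "card ?U \<le> card (J \<times> (UNIV :: bool set))"
      using \<open>finite J\<close> by (intro card_inj_on_le) auto
    then show ?thesis
      using assms(2) by (simp add: card_cartesian_product)
  qed
  then have "nat \<lceil>real l / 2\<rceil> \<le> card J"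
    by (simp add: nat_le_iff ceiling_le_iff)
  moreover have "card J \<le> k"
    using card_mono[OF _ J] by simp
  ultimately show ?thesis
    using box_G unfolding k_def by linarith
qed

end
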